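(* Let $\mathbb{F}$ be a field of characteristic different from $2$ and let $G$ be a connected graph containing no cycle of even length. Then $mr^{-}(\mathbb{F},G)=2\,match(G)=MR^{-}(\mathbb{F},G)$.
   Context: All graphs are finite and simple. For a field $\mathbb{F}$ and a graph $G$ on vertices $v_1,\dots,v_n$, $S^{-}(\mathbb{F},G)$ is the set of skew-symmetric matrices $A\in\mathbb{F}^{n\times n}$ ($A^T=-A$) such that for $i\neq j$, $a_{ij}\neq0$ iff $v_iv_j$ is an edge of $G$. $mr^{-}(\mathbb{F},G)=\min\{\operatorname{rank}A: A\in S^{-}(\mathbb{F},G)\}$ and $MR^{-}(\mathbb{F},G)=\max\{\operatorname{rank}A: A\in S^{-}(\mathbb{F},G)\}$. $match(G)$ is the matching number of $G$ (maximum number of pairwise disjoint edges). *)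

theory Defs
  imports
    "Graph_Theory.Graph_Theory"
    "Jordan_Normal_Form.DL_Rank"
    "HOL-Computational_Algebra.Computational_Algebra"
begin

(* The library locale graph models a finite simple graph as a finite symmetric digraph without
   loops and without parallel arcs: each edge uv is represented by the two arcs (u,v) and (v,u). *)

definition edge_set :: "('v, 'e) pre_digraph \<Rightarrow> 'v set set" where
  "edge_set G = {{u, v} | u v. u \<rightarrow>\<^bsub>G\<^esub> v}"

(* The closed walk u,v,u is a cycle of a symmetric digraph but not of the undirected graph;
   requiring at least three arcs excludes exactly these. *)
definition undirected_cycle :: "('v, 'e) pre_digraph \<Rightarrow> 'e list \<Rightarrow> bool" where
  "undirected_cycle G p \<longleftrightarrow> pre_digraph.cycle G p \<and> 3 \<le> length p"

definition is_matching :: "('v, 'e) pre_digraph \<Rightarrow> 'v set set \<Rightarrow> bool" where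
  "is_matching G M \<longleftrightarrow> M \<subseteq> edge_set G \<and> pairwise disjnt M"

definition matching_number :: "('v, 'e) pre_digraph \<Rightarrow> nat" where
  "matching_number G = Max {card M | M. is_matching G M}"

(* The list vs is the enumeration v_1, ..., v_n of the vertices (shifted to start at index 0).
   The diagonal is restricted by skew-symmetry only. *)
definition skew_matrices :: "'v list \<Rightarrow> ('v, 'e) pre_digraph \<Rightarrow> 'f::field mat set" where
  "skew_matrices vs G =
     {A \<in> carrier_mat (length vs) (length vs).
        transpose_mat A = - A \<and>
        (\<forall>i < length vs. \<forall>j < length vs. i \<noteq> j \<longrightarrow>
           (A $$ (i, j) \<noteq> 0 \<longleftrightarrow> vs ! i \<rightarrow>\<^bsub>G\<^esub> vs ! j))}"

definition skew_ranks :: "'f::field itself \<Rightarrow> 'v list \<Rightarrow> ('v, 'e) pre_digraph \<Rightarrow> nat set" where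
  "skew_ranks F vs G =
     {vec_space.rank (length vs) A | A. A \<in> (skew_matrices vs G :: 'f mat set)}"

definition min_skew_rank :: "'f::field itself \<Rightarrow> 'v list \<Rightarrow> ('v, 'e) pre_digraph \<Rightarrow> nat" where
  "min_skew_rank F vs G = Min (skew_ranks F vs G)"

definition max_skew_rank :: "'f::field itself \<Rightarrow> 'v list \<Rightarrow> ('v, 'e) pre_digraph \<Rightarrow> nat" where
  "max_skew_rank F vs G = Max (skew_ranks F vs G)"

(* The extrema above are taken over finite nonempty sets. *)

lemma matching_cards_finite_nonempty:
  assumes "graph G"
  shows "finite {card M | M. is_matching G M}" and "{card M | M. is_matching G M} \<noteq> {}"
proof -
  interpret graph G by fact
  have "edge_set G \<subseteq> Pow (verts G)"
    by (auto simp: edge_set_def dest: adj_in_verts)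
  then have "finite (edge_set G)"
    by (rule finite_subset) simp
  moreover have "{card M | M. is_matching G M} \<subseteq> card ` Pow (edge_set G)"
    by (auto simp: is_matching_def)
  ultimately show "finite {card M | M. is_matching G M}"
    by (meson finite_Pow_iff finite_imageI finite_subset)
  have "is_matching G {}"
    by (simp add: is_matching_def)
  then show "{card M | M. is_matching G M} \<noteq> {}"
    by blast
qed

lemma skew_ranks_finite: "finite (skew_ranks F vs G)"
proof (rule finite_subset)
  show "skew_ranks F vs G \<subseteq> {..length vs}"
    by (auto simp: skew_ranks_def skew_matrices_def intro: vec_space.rank_le_nc)
qed simp

lemma skew_ranks_nonempty:
  fixes F :: "'f::field itself"
  assumes "graph G"
  shows "skew_ranks F vs G \<noteq> {}"
proof -
  interpret graph G by fact
  define A :: "'f mat" where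
    "A = mat (length vs) (length vs) (\<lambda>(i, j).
       if i \<noteq> j \<and> vs ! i \<rightarrow>\<^bsub>G\<^esub> vs ! j then if i < j then 1 else - 1 else 0)"
  have sym: "u \<rightarrow>\<^bsub>G\<^esub> v \<longleftrightarrow> v \<rightarrow>\<^bsub>G\<^esub> u" for u v
    by (meson arcs_ends_conv symmetric_conv sym_arcs symmetric_def symE)
  have "transpose_mat A = - A"
    by (rule eq_matI) (auto simp: A_def sym)
  then have "A \<in> skew_matrices vs G"
    by (auto simp: skew_matrices_def A_def)
  then show ?thesis
    by (auto simp: skew_ranks_def)
qed

end

theory Submission
  imports Defs
begin

text \<open>Call a vertex set \<open>S\<close> nonsingular if the principal submatrix of \<open>A\<close> on \<open>S\<close> is. A maximal set
  of independent columns of a skew-symmetric matrix is nonsingular, so \<open>rank A\<close> is the largest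
  size of a nonsingular set. A nonsingular set always has a perfect matching: solving
  \<open>A x = e\<^sub>v\<close> on \<open>S\<close> gives \<open>x\<^sub>v = 0\<close>, hence a neighbour \<open>u\<close> of \<open>v\<close> with \<open>x\<^sub>u \<noteq> 0\<close>, and then
  \<open>S - {u, v}\<close> is nonsingular again. Conversely a set with exactly one perfect matching is
  nonsingular, by removing a matching edge \<open>uv\<close>: if \<open>A\<close> became singular on \<open>S\<close>, the kernel vector
  would single out another neighbour \<open>x\<close> of \<open>v\<close> with \<open>S - {v, x}\<close> nonsingular, hence perfectly
  matched. Finally two different perfect matchings of the same set produce an alternating cycle,
  which has even length.\<close>

section \<open>Alternating forms\<close>

text \<open>The zero diagonal is an axiom of its own because \<open>skew\<close> yields it only
  where 2 is invertible; the locale is thereby free of conditions on the characteristic.\<close>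

locale alternating_form =
  fixes V :: "'v set" and a :: "'v \<Rightarrow> 'v \<Rightarrow> 'f::field"
  assumes finite_V: "finite V"
    and skew: "\<And>i j. i \<in> V \<Longrightarrow> j \<in> V \<Longrightarrow> a i j = - a j i"
    and diag: "\<And>i. i \<in> V \<Longrightarrow> a i i = 0"
begin

definition app :: "('v \<Rightarrow> 'f) \<Rightarrow> 'v \<Rightarrow> 'f" where
  "app x i = (\<Sum>j\<in>V. a i j * x j)"

text \<open>Vectors indexed by a subset are total functions vanishing off it, so that one operator
  \<open>app\<close>, summing over all of \<open>V\<close>, serves every principal
  submatrix.\<close>

definition supported :: "'v set \<Rightarrow> ('v \<Rightarrow> 'f) \<Rightarrow> bool" where
  "supported S x \<longleftrightarrow> (\<forall>j. j \<notin> S \<longrightarrow> x j = 0)"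

definition nonsingular :: "'v set \<Rightarrow> bool" where
  "nonsingular S \<longleftrightarrow>
    (\<forall>x. supported S x \<longrightarrow> (\<forall>i\<in>S. app x i = 0) \<longrightarrow> (\<forall>j. x j = 0))"

lemma nonsingularD:
  "nonsingular S \<Longrightarrow> supported S x \<Longrightarrow> (\<And>i. i \<in> S \<Longrightarrow> app x i = 0) \<Longrightarrow> x j = 0"
  by (auto simp: nonsingular_def)

lemma supported_mono: "supported S x \<Longrightarrow> S \<subseteq> T \<Longrightarrow> supported T x"
  by (auto simp: supported_def)

lemma app_diff_scale: "app (\<lambda>j. x j - c * y j) i = app x i - c * app y i"
  by (simp add: app_def sum_subtractf sum_distrib_left algebra_simps)

lemma supported_diff_scale:
  "supported S x \<Longrightarrow> supported S y \<Longrightarrow> supported S (\<lambda>j. x j - c * y j)"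
  by (simp add: supported_def)

lemma app_skew: "(\<Sum>i\<in>V. x i * app y i) = - (\<Sum>i\<in>V. y i * app x i)"
proof -
  have "(\<Sum>i\<in>V. x i * app y i) = (\<Sum>i\<in>V. \<Sum>j\<in>V. x i * a i j * y j)"
    by (simp add: app_def sum_distrib_left mult.assoc)
  also have "\<dots> = (\<Sum>j\<in>V. \<Sum>i\<in>V. x i * a i j * y j)"
    by (rule sum.swap)
  also have "\<dots> = (\<Sum>j\<in>V. \<Sum>i\<in>V. - (y j * (a j i * x i)))"
    by (intro sum.cong refl, subst skew) (auto simp: mult_ac)
  also have "\<dots> = - (\<Sum>i\<in>V. y i * app x i)"
    by (simp add: app_def sum_distrib_left sum_negf)
  finally show ?thesis .
qed

text \<open>Induction on \<open>T\<close>, since \<open>app_skew\<close> with equal arguments would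
  control only twice the sum: when \<open>v\<close> joins, its row and column cancel and its
  diagonal term is zero.\<close>

lemma alternating_on_subset:
  assumes "finite T" "T \<subseteq> V"
  shows "(\<Sum>i\<in>T. \<Sum>j\<in>T. x i * a i j * x j) = 0"
  using assms
proof (induction T)
  case (insert v T)
  have "(\<Sum>i\<in>T. x i * a i v * x v) = - (\<Sum>j\<in>T. x v * a v j * x j)"
    unfolding sum_negf[symmetric]
    using insert.prems by (intro sum.cong refl, subst skew) (auto simp: mult_ac)
  with insert show ?case
    by (simp add: sum.distrib diag)
qed simp

lemma app_alternating: "(\<Sum>i\<in>V. x i * app x i) = 0"
  using alternating_on_subset[OF finite_V, of x]
  by (simp add: app_def sum_distrib_left mult.assoc)

lemma sum_single:
  assumes "v \<in> V" "\<And>i. i \<in> V \<Longrightarrow> i \<noteq> v \<Longrightarrow> y i * z i = 0"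
  shows "(\<Sum>i\<in>V. y i * z i) = y v * (z v :: 'f)"
  using sum.remove[OF finite_V assms(1), of "\<lambda>i. y i * z i"] assms(2)
  by (simp add: sum.neutral)

text \<open>Evaluate the form on \<open>y\<close> and \<open>x\<close> in both orders: one sum
  collapses to its term at \<open>v\<close>, the other to 0, and skewness makes them agree up to
  sign.\<close>

lemma app_pairing:
  assumes "v \<in> V" "supported S x" "supported S y"
    and "\<And>i. i \<in> S \<Longrightarrow> i \<noteq> v \<Longrightarrow> app x i = 0" "\<And>i. i \<in> S \<Longrightarrow> app y i = 0"
  shows "y v * app x v = 0"
proof -
  have "(\<Sum>i\<in>V. y i * app x i) = y v * app x v"
    by (rule sum_single) (use assms in \<open>auto simp: supported_def\<close>)
  moreover have "(\<Sum>i\<in>V. x i * app y i) = 0"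
    by (rule sum.neutral) (use assms in \<open>auto simp: supported_def\<close>)
  ultimately show ?thesis
    using app_skew[of y x] by simp
qed

lemma app_self_pairing:
  assumes "v \<in> V" "supported S x" "\<And>i. i \<in> S \<Longrightarrow> i \<noteq> v \<Longrightarrow> app x i = 0"
  shows "x v * app x v = 0"
proof -
  have "(\<Sum>i\<in>V. x i * app x i) = x v * app x v"
    by (rule sum_single) (use assms in \<open>auto simp: supported_def\<close>)
  then show ?thesis
    using app_alternating[of x] by simp
qed

text \<open>In the next lemma \<open>r\<close> spans the kernel of the form on \<open>T\<close>.\<close>

lemma nonsingular_remove:
  assumes "T \<subseteq> V" "v \<in> T" "supported T r" "r v \<noteq> 0"
    and ker: "\<And>i. i \<in> T \<Longrightarrow> app r i = 0"
    and line: "\<And>y. supported T y \<Longrightarrow> (\<And>i. i \<in> T \<Longrightarrow> app y i = 0) \<Longrightarrow> \<exists>c. \<forall>j. y j = c * r j"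
  shows "nonsingular (T - {v})"
  unfolding nonsingular_def
proof (intro allI impI)
  fix y j assume y: "supported (T - {v}) y" "\<forall>i\<in>T - {v}. app y i = 0"
  then have yT: "supported T y"
    using supported_mono by blast
  \<comment> \<open>Pairing with \<open>r\<close> recovers the missing equation in row
    \<open>v\<close>, so \<open>y\<close> lies in the kernel on all of \<open>T\<close> and is a
    multiple of \<open>r\<close>.\<close>
  have "r v * app y v = 0"
    by (rule app_pairing[of v T]) (use assms y yT in auto)
  then have "app y i = 0" if "i \<in> T" for i
    using that y \<open>r v \<noteq> 0\<close> by (cases "i = v") auto
  then obtain c where c: "\<And>j. y j = c * r j"
    using line[OF yT] by blast
  have "y v = 0"
    using y by (auto simp: supported_def)
  with c \<open>r v \<noteq> 0\<close> show "y j = 0"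
    by (metis mult_eq_0_iff)
qed

end

text \<open>Gaussian elimination by induction on the equations: an equation with a nonzero
  coefficient at \<open>k\<close> is solved for that unknown, which leaves one equation and one
  unknown fewer.\<close>

lemma homogeneous_system:
  fixes a :: "'i \<Rightarrow> 'j \<Rightarrow> 'f::field"
  assumes "finite I" "finite J" "card I < card J"
  shows "\<exists>x. (\<exists>j\<in>J. x j \<noteq> 0) \<and> (\<forall>j. j \<notin> J \<longrightarrow> x j = 0) \<and> (\<forall>i\<in>I. (\<Sum>j\<in>J. a i j * x j) = 0)"
  using assms
proof (induction I arbitrary: a J rule: finite_induct)
  case empty
  then obtain j where "j \<in> J"
    by fastforce
  then show ?case
    by (intro exI[of _ "\<lambda>k. if k = j then 1 else 0"]) auto
next
  case (insert i I)
  show ?case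
  proof (cases "\<forall>j\<in>J. a i j = 0")
    case True
    moreover have "card I < card J"
      using insert by simp
    ultimately show ?thesis
      using insert.IH[OF \<open>finite J\<close>, of a] by auto
  next
    case False
    then obtain k where k: "k \<in> J" "a i k \<noteq> 0"
      by blast
    define J' where "J' = J - {k}"
    \<comment> \<open>The coefficients of the remaining equations after eliminating the unknown
      \<open>k\<close> with the pivot \<open>a i k\<close>; \<open>y\<close> below is the back
      substitution.\<close>
    define b where "b l j = a l j - a l k * a i j / a i k" for l j
    have J': "finite J'" "card I < card J'" "J = insert k J'" "k \<notin> J'"
      using insert k by (auto simp: J'_def card_Diff_singleton_if)
    obtain x where x: "\<exists>j\<in>J'. x j \<noteq> 0" "\<forall>j. j \<notin> J' \<longrightarrow> x j = 0"
      "\<And>l. l \<in> I \<Longrightarrow> (\<Sum>j\<in>J'. b l j * x j) = 0"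
      using insert.IH[OF J'(1,2), of b] by auto
    define s where "s = (\<Sum>j\<in>J'. a i j * x j)"
    define y where "y = x(k := - s / a i k)"
    have y: "(\<Sum>j\<in>J. a l j * y j) = (\<Sum>j\<in>J'. a l j * x j) - a l k * s / a i k" for l
    proof -
      have "(\<Sum>j\<in>J'. a l j * y j) = (\<Sum>j\<in>J'. a l j * x j)"
        using J'(4) by (intro sum.cong) (auto simp: y_def)
      then show ?thesis
        using J' by (simp add: y_def)
    qed
    have "(\<Sum>j\<in>J. a l j * y j) = 0" if "l \<in> I" for l
    proof -
      have "(\<Sum>j\<in>J'. b l j * x j) = (\<Sum>j\<in>J'. a l j * x j) - a l k / a i k * s"
        by (simp add: b_def s_def sum_distrib_left sum_subtractf algebra_simps)
      with x(3)[OF that] y[of l] show ?thesis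
        by simp
    qed
    moreover have "(\<Sum>j\<in>J. a i j * y j) = 0"
      using k y[of i] by (simp add: s_def)
    moreover have "\<exists>j\<in>J. y j \<noteq> 0" "\<forall>j. j \<notin> J \<longrightarrow> y j = 0"
      using x J' by (auto simp: y_def)
    ultimately show ?thesis
      by (intro exI[of _ y]) auto
  qed
qed

section \<open>Nonsingular sets versus perfect matchings and independent columns\<close>

context alternating_form
begin

lemma exists_kernel_vector:
  assumes "J \<subseteq> V" "I \<subseteq> V" "card I < card J"
  obtains x where "supported J x" "\<exists>j\<in>J. x j \<noteq> 0" "\<And>i. i \<in> I \<Longrightarrow> app x i = 0"
proof -
  have fin: "finite I" "finite J"
    using assms finite_V finite_subset by blast+
  obtain x where x: "\<exists>j\<in>J. x j \<noteq> 0" "\<forall>j. j \<notin> J \<longrightarrow> x j = 0"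
    "\<And>i. i \<in> I \<Longrightarrow> (\<Sum>j\<in>J. a i j * x j) = 0"
    using homogeneous_system[OF fin \<open>card I < card J\<close>, of a] by auto
  have "app x i = (\<Sum>j\<in>J. a i j * x j)" for i
    unfolding app_def
    using assms(1) x(2) finite_V by (intro sum.mono_neutral_right) auto
  with x show ?thesis
    by (intro that[of x]) (auto simp: supported_def)
qed

lemma app_nonzeroD:
  assumes "app x v \<noteq> 0" "supported S x"
  shows "\<exists>u\<in>S. a v u \<noteq> 0 \<and> x u \<noteq> 0"
proof (rule ccontr)
  assume "\<not> ?thesis"
  then have "a v u * x u = 0" for u
    using assms(2) by (auto simp: supported_def)
  with assms(1) show False
    by (simp add: app_def)
qed

definition edges :: "'v set set" where
  "edges = {{i, j} | i j. i \<in> V \<and> j \<in> V \<and> a i j \<noteq> 0}"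

definition perfect_matching :: "'v set set \<Rightarrow> 'v set \<Rightarrow> bool" where
  "perfect_matching M S \<longleftrightarrow> M \<subseteq> edges \<and> pairwise disjnt M \<and> \<Union>M = S"

lemma perfect_matching_insert:
  assumes "perfect_matching M (S - {u, v})" "u \<in> S" "v \<in> S" "S \<subseteq> V" "a u v \<noteq> 0"
  shows "perfect_matching (insert {u, v} M) S"
proof -
  have "disjnt {u, v} e" if "e \<in> M" for e
    using assms(1) that by (auto simp: perfect_matching_def disjnt_def)
  then have "pairwise disjnt (insert {u, v} M)"
    using assms(1) by (auto simp: perfect_matching_def pairwise_insert disjnt_sym)
  moreover have "{u, v} \<in> edges"
    using assms by (auto simp: edges_def)
  ultimately show ?thesis
    using assms by (auto simp: perfect_matching_def)
qed

text \<open>A nonzero \<open>x\<close> killed by all rows of \<open>S\<close> but \<open>v\<close>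
  has \<open>x v = 0\<close>, so it spans the kernel on \<open>S - {v}\<close>. Deleting any vertex
  of its support restores nonsingularity, and row \<open>v\<close> supplies such a vertex adjacent
  to \<open>v\<close>.\<close>

lemma nonsingular_remove_edge:
  assumes "nonsingular S" "S \<subseteq> V" "v \<in> S"
  obtains u where "u \<in> S" "u \<noteq> v" "a v u \<noteq> 0" "nonsingular (S - {u, v})"
proof -
  have "finite S"
    using assms finite_V finite_subset by blast
  then have "card (S - {v}) < card S"
    using assms by (intro card_Diff1_less)
  then obtain x where x: "supported S x" "\<exists>j\<in>S. x j \<noteq> 0"
    "\<And>i. i \<in> S - {v} \<Longrightarrow> app x i = 0"
    using exists_kernel_vector[of S "S - {v}"] assms by blast
  have xv: "app x v \<noteq> 0"
    using nonsingularD[OF assms(1) x(1)] x by (metis Diff_iff singletonD)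
  moreover have "x v * app x v = 0"
    by (rule app_self_pairing[of v S]) (use assms x in auto)
  ultimately have "x v = 0"
    by simp
  then have xS: "supported (S - {v}) x"
    using x(1) by (auto simp: supported_def)
  obtain u where u: "u \<in> S - {v}" "a v u \<noteq> 0" "x u \<noteq> 0"
    using app_nonzeroD[OF xv xS] by blast
  have "nonsingular (S - {v} - {u})"
  proof (rule nonsingular_remove[OF _ u(1) xS u(3) x(3)])
    fix y assume y: "supported (S - {v}) y" "\<And>i. i \<in> S - {v} \<Longrightarrow> app y i = 0"
    \<comment> \<open>Chosen so that row \<open>v\<close> kills \<open>y - c x\<close> as well,
      which then vanishes by nonsingularity of \<open>S\<close>.\<close>
    define c where "c = app y v / app x v"
    have "y j - c * x j = 0" for j
    proof (rule nonsingularD[OF assms(1), where x = "\<lambda>j. y j - c * x j"])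
      show "supported S (\<lambda>j. y j - c * x j)"
        using supported_diff_scale[OF y(1) xS] supported_mono by blast
      show "app (\<lambda>j. y j - c * x j) i = 0" if "i \<in> S" for i
        unfolding app_diff_scale using that x(3) y(2) xv by (cases "i = v") (auto simp: c_def)
    qed
    then show "\<exists>c. \<forall>j. y j = c * x j"
      by auto
  qed (use assms in auto)
  moreover have "S - {v} - {u} = S - {u, v}"
    by auto
  ultimately show ?thesis
    using u that by auto
qed

lemma nonsingular_imp_perfect_matching:
  assumes "nonsingular S" "S \<subseteq> V"
  shows "\<exists>M. perfect_matching M S"
proof -
  have "finite S"
    using assms finite_V finite_subset by blast
  then show ?thesis
    using assms
  proof (induction S rule: finite_psubset_induct)
    case (psubset S)
    show ?case
    proof (cases "S = {}")
      case True
      then show ?thesis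
        by (auto simp: perfect_matching_def intro: exI[of _ "{}"])
    next
      case False
      then obtain v where v: "v \<in> S"
        by blast
      obtain u where u: "u \<in> S" "u \<noteq> v" "a v u \<noteq> 0" "nonsingular (S - {u, v})"
        using nonsingular_remove_edge[OF psubset.prems v] .
      have "S - {u, v} \<subset> S" "S - {u, v} \<subseteq> V"
        using v psubset.prems by auto
      then obtain M where "perfect_matching M (S - {u, v})"
        using psubset.IH u by blast
      then have "perfect_matching M (S - {v, u})"
        by (simp add: insert_commute)
      then show ?thesis
        using perfect_matching_insert u v psubset.prems by blast
    qed
  qed
qed

lemma perfect_matching_remove:
  assumes "perfect_matching M S" "{u, v} \<in> M"
  shows "perfect_matching (M - {{u, v}}) (S - {u, v})"
proof -
  have "\<Union>(M - {{u, v}}) = S - {u, v}"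
  proof (intro equalityI subsetI)
    fix w assume "w \<in> \<Union>(M - {{u, v}})"
    then obtain e where e: "e \<in> M" "e \<noteq> {u, v}" "w \<in> e"
      by blast
    have "disjnt e {u, v}"
      using assms e(1,2) pairwiseD[of disjnt M] unfolding perfect_matching_def by metis
    with e assms show "w \<in> S - {u, v}"
      by (auto simp: perfect_matching_def disjnt_def)
  qed (use assms in \<open>auto simp: perfect_matching_def\<close>)
  then show ?thesis
    using assms by (auto simp: perfect_matching_def intro: pairwise_subset)
qed

text \<open>Uniqueness is asked of all vertex sets so that it is at hand throughout the induction.
  With a matching edge \<open>{u, v}\<close> removed, \<open>S'\<close> is nonsingular, the kernel
  on \<open>insert u S'\<close> is a line spanned by some \<open>r\<close>, and everything rests on
  row \<open>v\<close> not killing \<open>r\<close>.\<close>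

lemma unique_perfect_matching_imp_nonsingular:
  assumes unique: "\<And>S M M'. perfect_matching M S \<Longrightarrow> perfect_matching M' S \<Longrightarrow> M = M'"
    and "perfect_matching M S"
  shows "nonsingular S"
proof -
  have "\<Union>edges \<subseteq> V"
    by (auto simp: edges_def)
  then have "S \<subseteq> V"
    using assms(2) by (auto simp: perfect_matching_def)
  then have "finite S"
    using finite_V finite_subset by blast
  from this \<open>S \<subseteq> V\<close> assms(2) show ?thesis
  proof (induction S arbitrary: M rule: finite_psubset_induct)
    case (psubset S)
    show ?case
    proof (cases "M = {}")
      case True
      then show ?thesis
        using psubset.prems by (auto simp: nonsingular_def perfect_matching_def supported_def)
    next
      case False
      then obtain e where "e \<in> M" "e \<in> edges"
        using psubset.prems by (auto simp: perfect_matching_def)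
      then obtain u v where uv: "{u, v} \<in> M" "a u v \<noteq> 0" "u \<in> V" "v \<in> V"
        unfolding edges_def by blast
      have "u \<noteq> v"
        using uv diag by auto
      have S: "u \<in> S" "v \<in> S"
        using uv psubset.prems by (auto simp: perfect_matching_def)
      define S' where "S' = S - {u, v}"
      have S'V: "S' \<subseteq> V" "u \<notin> S'" "v \<notin> S'" "S = insert v (insert u S')" "finite S'"
        using S psubset.hyps psubset.prems(1) by (auto simp: S'_def)
      have "S' \<subset> S"
        using S by (auto simp: S'_def)
      moreover have "perfect_matching (M - {{u, v}}) S'"
        using perfect_matching_remove[OF psubset.prems(2) uv(1)] by (simp add: S'_def)
      ultimately have ns: "nonsingular S'"
        using psubset.IH S'V(1) by blast
      have "card S' < card (insert u S')"
        using S'V by simp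
      then obtain r where r: "supported (insert u S') r" "\<exists>j\<in>insert u S'. r j \<noteq> 0"
        "\<And>i. i \<in> S' \<Longrightarrow> app r i = 0"
        using exists_kernel_vector[of "insert u S'" S'] S'V uv by blast
      have ru: "r u \<noteq> 0"
      proof
        assume "r u = 0"
        then have "supported S' r"
          using r(1) by (auto simp: supported_def)
        then show False
          using nonsingularD[OF ns] r by blast
      qed
      \<comment> \<open>\<open>r\<close> was chosen for the rows in \<open>S'\<close> only;
        alternation adds row \<open>u\<close>.\<close>
      have "r u * app r u = 0"
        by (rule app_self_pairing[of u "insert u S'"]) (use uv r in auto)
      with ru r have ker: "app r i = 0" if "i \<in> insert u S'" for i
        using that by auto
      have line: "\<exists>c. \<forall>j. y j = c * r j"
        if y: "supported (insert u S') y" "\<And>i. i \<in> S' \<Longrightarrow> app y i = 0" for y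
      proof -
        \<comment> \<open>Matching the coordinate at \<open>u\<close> makes \<open>y - c r\<close>
          supported on \<open>S'\<close>, where the form is nonsingular.\<close>
        define c where "c = y u / r u"
        have "y j - c * r j = 0" for j
        proof (rule nonsingularD[OF ns, where x = "\<lambda>j. y j - c * r j"])
          show "supported S' (\<lambda>j. y j - c * r j)"
            unfolding supported_def
          proof (intro allI impI)
            fix j assume "j \<notin> S'"
            then show "y j - c * r j = 0"
              using y(1) r(1) ru by (cases "j = u") (simp_all add: supported_def c_def)
          qed
          show "app (\<lambda>j. y j - c * r j) i = 0" if "i \<in> S'" for i
            using that y r by (simp add: app_diff_scale)
        qed
        then show ?thesis
          by auto
      qed
      txt \<open>If \<open>app r v\<close> vanished, the term \<open>a v u * r u\<close> would be cancelled by some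
        \<open>a v x * r x\<close>, and \<open>x\<close> would be the partner of \<open>v\<close> in a second perfect matching.\<close>
      have rv: "app r v \<noteq> 0"
      proof
        assume "app r v = 0"
        have "r v = 0"
          using r(1) S'V(3) \<open>u \<noteq> v\<close> by (auto simp: supported_def)
        have "\<exists>x\<in>S'. a v x \<noteq> 0 \<and> r x \<noteq> 0"
        proof (rule ccontr)
          assume none: "\<not> ?thesis"
          have "app r v = a v u * r u"
            unfolding app_def
          proof (rule sum_single)
            show "a v i * r i = 0" if "i \<in> V" "i \<noteq> u" for i
              using that none r(1) by (cases "i \<in> S'") (auto simp: supported_def)
          qed (use uv in auto)
          with \<open>app r v = 0\<close> ru uv skew[of u v] show False
            by simp
        qed
        then obtain x where x: "x \<in> S'" "a v x \<noteq> 0" "r x \<noteq> 0"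
          by blast
        have "nonsingular (insert u S' - {x})"
          by (rule nonsingular_remove[of _ _ r]) (use x r ker line S'V uv in auto)
        moreover have Tx: "insert u S' - {x} = S - {v, x}"
          using S'V x \<open>u \<noteq> v\<close> by auto
        ultimately obtain N where "perfect_matching N (S - {v, x})"
          using nonsingular_imp_perfect_matching psubset.prems by (metis Diff_subset subset_trans)
        then have "perfect_matching (insert {v, x} N) S"
          using perfect_matching_insert S x S'V psubset.prems by blast
        then have "{v, x} \<in> M"
          using unique psubset.prems by blast
        \<comment> \<open>Both edges would lie in \<open>M\<close> and meet in \<open>v\<close>, yet
          they differ because \<open>u\<close> is not in \<open>S'\<close>.\<close>
        moreover have "{v, x} \<noteq> {u, v}" "\<not> disjnt {v, x} {u, v}"
          using x S'V by (auto simp: doubleton_eq_iff)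
        ultimately show False
          using uv(1) psubset.prems(2) pairwiseD[of disjnt M] unfolding perfect_matching_def
          by metis
      qed
      show ?thesis
        unfolding nonsingular_def
      proof (intro allI impI)
        fix z j assume z: "supported S z" "\<forall>i\<in>S. app z i = 0"
        \<comment> \<open>Among the rows in \<open>S\<close>, only row \<open>v\<close> fails to
          kill \<open>r\<close>, so pairing with \<open>r\<close> isolates \<open>z v\<close>. Then
          \<open>z\<close> lies on the line of \<open>r\<close>, and row \<open>v\<close> forces the
          factor to be 0.\<close>
        have "z v * app r v = 0"
        proof (rule app_pairing[of v S])
          show "supported S r"
            using r(1) S'V supported_mono by blast
        qed (use S'V uv z ker in auto)
        then have "z v = 0"
          using rv by simp
        then have "supported (insert u S') z"
          using z S'V by (auto simp: supported_def)
        then obtain c where c: "\<And>j. z j = c * r j"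
          using line z S'V by blast
        then have "app z v = c * app r v"
          by (simp add: app_def sum_distrib_left mult_ac)
        with z rv S have "c = 0"
          by auto
        with c show "z j = 0"
          by simp
      qed
    qed
  qed
qed

text \<open>All rows of \<open>V\<close> are tested here, not just those in \<open>S\<close>: this
  is linear independence of the full columns indexed by \<open>S\<close>.\<close>

definition independent :: "'v set \<Rightarrow> bool" where
  "independent S \<longleftrightarrow>
    (\<forall>x. supported S x \<longrightarrow> (\<forall>i\<in>V. app x i = 0) \<longrightarrow> (\<forall>j. x j = 0))"

lemma nonsingular_imp_independent: "nonsingular S \<Longrightarrow> S \<subseteq> V \<Longrightarrow> independent S"
  by (auto simp: nonsingular_def independent_def subset_iff)

text \<open>By maximality each column \<open>j\<close> outside \<open>S\<close> occurs in a relation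
  \<open>x\<close> with columns of \<open>S\<close>. Pairing \<open>x\<close> with a vector
  \<open>y\<close> killed by the rows in \<open>S\<close> shows that row \<open>j\<close> kills
  \<open>y\<close> too, so \<open>y\<close> is a relation among independent columns.\<close>

lemma maximal_independent_imp_nonsingular:
  assumes "S \<subseteq> V" "independent S"
    and maximal: "\<And>T. S \<subset> T \<Longrightarrow> T \<subseteq> V \<Longrightarrow> \<not> independent T"
  shows "nonsingular S"
  unfolding nonsingular_def
proof (intro allI impI)
  fix y k assume y: "supported S y" "\<forall>i\<in>S. app y i = 0"
  have "app y j = 0" if "j \<in> V" for j
  proof (cases "j \<in> S")
    case False
    then have "\<not> independent (insert j S)"
      using maximal[of "insert j S"] assms(1) that by blast
    then obtain x l where x: "supported (insert j S) x" "\<And>i. i \<in> V \<Longrightarrow> app x i = 0" "x l \<noteq> 0"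
      by (auto simp: independent_def)
    have "x j \<noteq> 0"
    proof
      assume "x j = 0"
      then have "supported S x"
        using x(1) by (auto simp: supported_def)
      then show False
        using assms(2) x(2,3) by (auto simp: independent_def)
    qed
    moreover have "x j * app y j = 0"
    proof (rule app_pairing[of j "insert j S"])
      show "supported (insert j S) y"
        using y(1) by (rule supported_mono) auto
    qed (use x y assms(1) that in auto)
    ultimately show ?thesis
      by simp
  qed (use y in auto)
  with assms(2) y(1) show "y k = 0"
    by (auto simp: independent_def)
qed

end

section \<open>Alternating cycles\<close>

text \<open>Apply the two involutions in turn, starting at \<open>u\<close>. Each step is undone by
  the involution that made it, so a first repetition that missed the start or had odd length could
  be shifted to an earlier one.\<close>

lemma alternating_sequence_closes:
  fixes m m' :: "'a \<Rightarrow> 'a"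
  assumes "finite S" "u \<in> S" "m u \<noteq> m' u"
    and m: "\<And>s. s \<in> S \<Longrightarrow> m s \<in> S \<and> m (m s) = s \<and> m s \<noteq> s"
    and m': "\<And>s. s \<in> S \<Longrightarrow> m' s \<in> S \<and> m' (m' s) = s \<and> m' s \<noteq> s"
  obtains w k where "\<And>n. w n \<in> S" "\<And>n. w (Suc n) = (if even n then m else m') (w n)"
    "w k = w 0" "even k" "3 \<le> k" "inj_on w {..<k}"
proof -
  define e where "e n = (if even n then m else m')" for n :: nat
  define w where "w = rec_nat u (\<lambda>n. e n)"
  have w0: "w 0 = u" and wS: "w (Suc n) = e n (w n)" for n
    by (auto simp: w_def)
  have in_S: "w n \<in> S" for n
    by (induction n) (use assms in \<open>auto simp: w0 wS e_def\<close>)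
  have step_back: "e n (w (Suc n)) = w n" for n
    using in_S[of n] m m' by (auto simp: wS e_def)
  have moves: "w (Suc n) \<noteq> w n" for n
    using in_S[of n] m m' by (auto simp: wS e_def)
  have par: "e n = e l" if "even n \<longleftrightarrow> even l" for n l
    using that by (simp add: e_def)
  have "\<not> inj w"
    using \<open>finite S\<close> in_S finite_subset[of "range w" S] finite_imageD infinite_UNIV_nat by blast
  then have ex: "\<exists>k. \<exists>i<k. w i = w k"
    unfolding inj_on_def by (metis linorder_neqE_nat)
  define k where "k = (LEAST k. \<exists>i<k. w i = w k)"
  obtain i where i: "i < k" "w i = w k"
    using LeastI_ex[OF ex] by (auto simp: k_def)
  have minimal: "w a \<noteq> w b" if "a < b" "b < k" for a b
    using not_less_Least[of b "\<lambda>k. \<exists>i<k. w i = w k"] that by (auto simp: k_def)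
  obtain k' where k': "k = Suc k'"
    using i(1) by (cases k) auto
  \<comment> \<open>With opposite parities, the step into \<open>k\<close> and the step out of
    \<open>i\<close> use the same involution, so positions \<open>Suc i\<close> and
    \<open>k'\<close> already agree.\<close>
  have parity: "even k \<longleftrightarrow> even i"
  proof (rule ccontr)
    assume "\<not> ?thesis"
    then have "even k' \<longleftrightarrow> even i"
      by (simp add: k')
    then have "e k' = e i"
      by (rule par)
    then have "w (Suc i) = w k'"
      using i(2) step_back[of k'] wS[of i] k' by metis
    moreover have "Suc i \<noteq> k'"
      using \<open>even k' \<longleftrightarrow> even i\<close> by auto
    moreover have "i \<noteq> k'"
      using moves[of k'] i(2) by (auto simp: k')
    ultimately show False
      using minimal[of "Suc i" k'] i(1) by (auto simp: k')
  qed
  \<comment> \<open>With equal parities and \<open>i > 0\<close>, the steps into \<open>i\<close>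
    and into \<open>k\<close> use the same involution, so their predecessors already agree.\<close>
  have "i = 0"
  proof (cases i)
    case (Suc i')
    then have "even k' \<longleftrightarrow> even i'"
      using parity by (simp add: k')
    then have "e k' = e i'"
      by (rule par)
    then have "w i' = w k'"
      using i(2) step_back[of k'] step_back[of i'] Suc k' by metis
    then show ?thesis
      using minimal[of i' k'] i(1) by (simp add: Suc k')
  qed
  \<comment> \<open>A return after two steps would mean \<open>m u = m' u\<close>; this is where the
    disagreement at \<open>u\<close> enters.\<close>
  have "k \<noteq> 2"
  proof
    assume "k = 2"
    then have "m' (m u) = u"
      using i(2) \<open>i = 0\<close> wS[of 0] wS[of 1] by (simp add: numeral_2_eq_2 w0 e_def)
    then show False
      using m m' assms(2,3) by metis
  qed
  have "inj_on w {..<k}"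
    using minimal unfolding inj_on_def by (metis lessThan_iff linorder_neqE_nat)
  moreover have "even k"
    using parity \<open>i = 0\<close> by simp
  moreover from this have "3 \<le> k"
    using \<open>k \<noteq> 2\<close> i(1) by (cases "k = 1") auto
  ultimately show ?thesis
    using that[of w k] i(2) \<open>i = 0\<close> in_S wS by (simp add: e_def)
qed

lemma (in wf_digraph) cycle_of_closed_sequence:
  assumes adj: "\<And>i. i < k \<Longrightarrow> w i \<rightarrow>\<^bsub>G\<^esub> w (Suc i)"
    and "w k = w 0" "0 < k" "inj_on w {..<k}"
  obtains p where "cycle p" "length p = k"
proof -
  have "\<exists>e. e \<in> arcs G \<and> tail G e = w i \<and> head G e = w (Suc i)" if "i < k" for i
    using adj[OF that] by (auto simp: arcs_ends_conv)
  then obtain f where f: "\<And>i. i < k \<Longrightarrow> f i \<in> arcs G \<and> tail G (f i) = w i \<and> head G (f i) = w (Suc i)"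
    by metis
  define p where "p = map f [0..<k]"
  have w0: "w 0 \<in> verts G"
    using f[OF \<open>0 < k\<close>] tail_in_verts by metis
  have "cas (w 0) (map f [0..<l]) (w l)" if "l \<le> k" for l
    using that by (induction l) (auto simp: f cas_append_iff awlast_if_cas)
  then have cas: "cas (w 0) p (w 0)"
    unfolding p_def using assms(2) by (metis order_refl)
  have "tl (awalk_verts (w 0) p) = map (\<lambda>i. w (Suc i)) [0..<k]"
    using \<open>0 < k\<close> by (subst awalk_verts_conv'[OF cas]) (auto simp: p_def f)
  moreover have "inj_on (\<lambda>i. w (Suc i)) {0..<k}"
  proof (rule inj_onI)
    fix i j assume ij: "i \<in> {0..<k}" "j \<in> {0..<k}" "w (Suc i) = w (Suc j)"
    \<comment> \<open>The shifted indices run from 1 to \<open>k\<close>; \<open>r\<close> wraps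
      \<open>k\<close> back to 0, into the range where \<open>w\<close> is injective.\<close>
    define r where "r n = (if n = k then 0 else n)" for n
    have "w (r n) = w n" for n
      using assms(2) by (simp add: r_def)
    then have "r (Suc i) = r (Suc j)"
      using ij assms(3) by (intro inj_onD[OF assms(4)]) (auto simp: r_def)
    then show "i = j"
      by (auto simp: r_def split: if_splits)
  qed
  ultimately have "cycle p"
    unfolding cycle_def awalk_def using cas w0 f \<open>0 < k\<close>
    by (intro exI[of _ "w 0"]) (auto simp: p_def distinct_map)
  then show ?thesis
    using that by (simp add: p_def)
qed

text \<open>Encodes a matching as a fixed-point-free involution on the vertices it covers, the form
  that the alternating walk requires.\<close>

lemma matching_partner:
  assumes "graph G" "is_matching G M"
  obtains m where "\<And>s t. {s, t} \<in> M \<longleftrightarrow> s \<in> \<Union>M \<and> t = m s"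
    "\<And>s. s \<in> \<Union>M \<Longrightarrow> m s \<in> \<Union>M \<and> m (m s) = s \<and> m s \<noteq> s \<and> s \<rightarrow>\<^bsub>G\<^esub> m s"
proof -
  interpret graph G by fact
  have sym: "u \<rightarrow>\<^bsub>G\<^esub> v \<longleftrightarrow> v \<rightarrow>\<^bsub>G\<^esub> u" for u v
    by (meson arcs_ends_conv symmetric_conv sym_arcs symmetric_def symE)
  have adj: "s \<rightarrow>\<^bsub>G\<^esub> t" if "{s, t} \<in> M" for s t
  proof -
    have "{s, t} \<in> edge_set G"
      using that assms(2) by (auto simp: is_matching_def)
    then show ?thesis
      using sym by (auto simp: edge_set_def doubleton_eq_iff)
  qed
  have "\<exists>t. {s, t} \<in> M" if s: "s \<in> \<Union>M" for s
  proof -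
    obtain e where e: "e \<in> M" "s \<in> e"
      using s by blast
    then obtain u v where "e = {u, v}"
      using assms(2) by (auto simp: is_matching_def edge_set_def)
    with e show ?thesis
      by (auto simp: insert_commute)
  qed
  then obtain m where m: "\<And>s. s \<in> \<Union>M \<Longrightarrow> {s, m s} \<in> M"
    by metis
  have unique: "t = t'" if "{s, t} \<in> M" "{s, t'} \<in> M" for s t t'
  proof -
    have "\<not> disjnt {s, t} {s, t'}"
      by simp
    then have "{s, t} = {s, t'}"
      using assms(2) that pairwiseD[of disjnt M] unfolding is_matching_def by metis
    then show ?thesis
      by (auto simp: doubleton_eq_iff)
  qed
  show ?thesis
  proof (rule that)
    show iff: "{s, t} \<in> M \<longleftrightarrow> s \<in> \<Union>M \<and> t = m s" for s t
      using m unique by blast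
    fix s assume s: "s \<in> \<Union>M"
    have "{m s, s} \<in> M"
      using m[OF s] by (simp add: insert_commute)
    then show "m s \<in> \<Union>M \<and> m (m s) = s \<and> m s \<noteq> s \<and> s \<rightarrow>\<^bsub>G\<^esub> m s"
      using iff[of "m s" s] adj[OF m[OF s]] adj_not_same by metis
  qed
qed

text \<open>The two partner involutions live on the same vertex set and disagree at some
  \<open>u\<close>; the alternating walk from \<open>u\<close> closes up to the cycle.\<close>

lemma matchings_differ_imp_even_cycle:
  assumes "graph G" "is_matching G M" "is_matching G M'" "\<Union>M = \<Union>M'" "M \<noteq> M'"
  shows "\<exists>p. undirected_cycle G p \<and> even (length p)"
proof -
  interpret graph G by fact
  obtain m where m: "\<And>s t. {s, t} \<in> M \<longleftrightarrow> s \<in> \<Union>M \<and> t = m s"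
    "\<And>s. s \<in> \<Union>M \<Longrightarrow> m s \<in> \<Union>M \<and> m (m s) = s \<and> m s \<noteq> s \<and> s \<rightarrow>\<^bsub>G\<^esub> m s"
    using matching_partner[OF assms(1,2)] by blast
  obtain m' where m': "\<And>s t. {s, t} \<in> M' \<longleftrightarrow> s \<in> \<Union>M \<and> t = m' s"
    "\<And>s. s \<in> \<Union>M \<Longrightarrow> m' s \<in> \<Union>M \<and> m' (m' s) = s \<and> m' s \<noteq> s \<and> s \<rightarrow>\<^bsub>G\<^esub> m' s"
    using matching_partner[OF assms(1,3)] unfolding assms(4) by blast
  have pairs: "\<exists>s t. e = {s, t}" if "e \<in> M \<union> M'" for e
    using that assms(2,3) unfolding is_matching_def edge_set_def by blast
  have "\<exists>u\<in>\<Union>M. m u \<noteq> m' u"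
  proof (rule ccontr)
    assume "\<not> ?thesis"
    then have "{s, t} \<in> M \<longleftrightarrow> {s, t} \<in> M'" for s t
      using m(1) m'(1) by metis
    then have "e \<in> M \<longleftrightarrow> e \<in> M'" for e
      using pairs by (metis UnI1 UnI2)
    then show False
      using assms(5) by blast
  qed
  then obtain u where u: "u \<in> \<Union>M" "m u \<noteq> m' u"
    by blast
  have "\<Union>M \<subseteq> verts G"
    using assms(2) by (auto simp: is_matching_def edge_set_def dest: adj_in_verts)
  then have fin: "finite (\<Union>M)"
    using finite_subset finite_verts by blast
  obtain w k where w: "\<And>n. w n \<in> \<Union>M" "\<And>n. w (Suc n) = (if even n then m else m') (w n)"
    "w k = w 0" "even k" "3 \<le> k" "inj_on w {..<k}"
    by (rule alternating_sequence_closes[where m = m and m' = m', OF fin u])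
      (use m(2) m'(2) in auto)
  have "w i \<rightarrow>\<^bsub>G\<^esub> w (Suc i)" for i
    using w(1)[of i] w(2)[of i] m(2) m'(2) by (auto simp del: Union_iff)
  then obtain p where "cycle p" "length p = k"
    using cycle_of_closed_sequence[of k w] w by auto
  with w show ?thesis
    by (auto simp: undirected_cycle_def)
qed

section \<open>Independent columns and rank\<close>

text \<open>The columns form a family indexed by \<open>S\<close>, not a set of vectors, so two
  equal columns count as dependent.\<close>

definition independent_cols :: "'f::field mat \<Rightarrow> ('v \<Rightarrow> nat) \<Rightarrow> 'v set \<Rightarrow> bool" where
  "independent_cols A h S \<longleftrightarrow>
    (\<forall>x. (\<forall>i<dim_row A. (\<Sum>v\<in>S. A $$ (i, h v) * x v) = 0) \<longrightarrow> (\<forall>v\<in>S. x v = 0))"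

text \<open>Bridge to the library notion for sets of vectors; injectivity lets coefficients move
  between indices and columns.\<close>

lemma lin_indpt_cols_iff:
  fixes A :: "'f::field mat"
  assumes A: "A \<in> carrier_mat n nc" and S: "finite S" "h ` S \<subseteq> {..<nc}"
    and inj: "inj_on (\<lambda>v. col A (h v)) S"
  shows "\<not> module.lin_dep class_ring (module_vec TYPE('f) n) ((\<lambda>v. col A (h v)) ` S) \<longleftrightarrow>
    independent_cols A h S"
proof -
  interpret vec_space "TYPE('f)" n .
  let ?c = "\<lambda>v. col A (h v)"
  have carrier: "?c ` S \<subseteq> carrier_vec n"
    using A by auto
  have index: "lincomb f (?c ` S) $ i = (\<Sum>v\<in>S. A $$ (i, h v) * f (?c v))" if "i < n" for f i
  proof -
    have "lincomb f (?c ` S) $ i = (\<Sum>v\<in>S. f (?c v) * ?c v $ i)"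
      using lincomb_index[OF that carrier] by (simp add: sum.reindex[OF inj])
    also have "\<dots> = (\<Sum>v\<in>S. A $$ (i, h v) * f (?c v))"
      using A S that by (intro sum.cong) (auto simp: mult.commute)
    finally show ?thesis .
  qed
  have zero: "lincomb f (?c ` S) = 0\<^sub>v n \<longleftrightarrow> (\<forall>i<n. (\<Sum>v\<in>S. A $$ (i, h v) * f (?c v)) = 0)" for f
    using lincomb_dim[OF finite_imageI[OF S(1)] carrier, of f] index
    by (auto simp: vec_eq_iff)
  show ?thesis
  proof
    assume indpt: "lin_indpt (?c ` S)"
    show "independent_cols A h S"
      unfolding independent_cols_def
    proof (intro allI impI ballI)
      fix x v assume x: "\<forall>i<dim_row A. (\<Sum>v\<in>S. A $$ (i, h v) * x v) = 0" and "v \<in> S"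
      define f where "f = (\<lambda>c. x (the_inv_into S ?c c))"
      have f: "f (?c v) = x v" if "v \<in> S" for v
        using the_inv_into_f_f[OF inj that] by (simp add: f_def)
      have "lincomb f (?c ` S) = 0\<^sub>v n"
        unfolding zero using x A f by simp
      then have "f (?c v) = 0"
        using indpt \<open>v \<in> S\<close> S(1) unfolding lin_dep_def by (auto simp: class_ring_simps)
      then show "x v = 0"
        using f \<open>v \<in> S\<close> by simp
    qed
  next
    assume ind: "independent_cols A h S"
    show "lin_indpt (?c ` S)"
    proof (rule finite_lin_indpt2)
      fix f assume "lincomb f (?c ` S) = 0\<^sub>v n"
      then show "\<forall>v\<in>?c ` S. f v = 0"
        using ind A unfolding zero independent_cols_def by auto
    qed (use S carrier in auto)
  qed
qed

lemma independent_cols_imp_inj: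
  assumes "independent_cols A h S" "finite S" "A \<in> carrier_mat n nc" "h ` S \<subseteq> {..<nc}"
  shows "inj_on (\<lambda>v. col A (h v)) S"
proof (rule inj_onI, rule ccontr)
  fix u v assume uv: "u \<in> S" "v \<in> S" "col A (h u) = col A (h v)" "u \<noteq> v"
  \<comment> \<open>The coefficients 1 and -1 on two equal columns give a nontrivial
    relation.\<close>
  define x where "x w = (if w = u then 1 else if w = v then - 1 else 0 :: 'a)" for w
  have "(\<Sum>w\<in>S. A $$ (i, h w) * x w) = 0" if "i < dim_row A" for i
  proof -
    have "(\<Sum>w\<in>S. A $$ (i, h w) * x w) = (\<Sum>w\<in>{u, v}. A $$ (i, h w) * x w)"
      using uv assms(2) by (intro sum.mono_neutral_right) (auto simp: x_def)
    also have "\<dots> = col A (h u) $ i - col A (h v) $ i"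
    proof -
      have "h u < dim_col A" "h v < dim_col A"
        using uv assms(3,4) by auto
      then show ?thesis
        using uv(4) that by (simp add: x_def)
    qed
    finally show ?thesis
      using uv(3) by simp
  qed
  then have "x u = 0"
    using assms(1) uv(1) unfolding independent_cols_def by blast
  then show False
    by (simp add: x_def)
qed

lemma card_independent_cols_le_rank:
  assumes "independent_cols A h S" "finite S" "A \<in> carrier_mat n nc" "h ` S \<subseteq> {..<nc}"
  shows "card S \<le> vec_space.rank n A"
proof -
  have inj: "inj_on (\<lambda>v. col A (h v)) S"
    using independent_cols_imp_inj[OF assms] .
  have "(\<lambda>v. col A (h v)) ` S \<subseteq> set (cols A)"
    using assms by (auto simp: cols_def)
  then have "card ((\<lambda>v. col A (h v)) ` S) \<le> vec_space.rank n A"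
    using vec_space.rank_ge_card_indpt[OF assms(3)] lin_indpt_cols_iff[OF assms(3,2,4) inj] assms(1)
    by blast
  then show ?thesis
    by (simp add: card_image[OF inj])
qed

lemma rank_attained_by_independent_cols:
  fixes A :: "'f::field mat"
  assumes A: "A \<in> carrier_mat n nc" and h: "h ` V = {..<nc}" "finite V"
  obtains S where "S \<subseteq> V" "card S = vec_space.rank n A" "independent_cols A h S"
proof -
  interpret vec_space "TYPE('f)" n .
  obtain U where U: "maximal U (\<lambda>T. T \<subseteq> set (cols A) \<and> lin_indpt T)"
    using maximal_exists_superset[of "set (cols A)" "\<lambda>T. T \<subseteq> set (cols A) \<and> lin_indpt T" "{}"]
    by (auto simp: lin_dep_def)
  then have "U \<subseteq> set (cols A)" "lin_indpt U"
    by (auto simp: maximal_def)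
  moreover have "set (cols A) = (\<lambda>v. col A (h v)) ` V"
    using A h(1) by (simp add: cols_def atLeast0LessThan flip: image_image)
  \<comment> \<open>\<open>subset_image_inj\<close> selects one index for each column in
    \<open>U\<close>.\<close>
  ultimately obtain S where S: "S \<subseteq> V" "inj_on (\<lambda>v. col A (h v)) S" "U = (\<lambda>v. col A (h v)) ` S"
    by (metis subset_image_inj)
  have "finite S" "h ` S \<subseteq> {..<nc}"
    using S(1) h finite_subset by auto
  then have "independent_cols A h S"
    using lin_indpt_cols_iff[OF A _ _ S(2)] \<open>lin_indpt U\<close> S(3) by blast
  moreover have "card S = rank A"
    using rank_card_indpt[OF A U] S card_image by metis
  ultimately show ?thesis
    using that S by blast
qed

section \<open>Rank and matching number\<close>

lemma matching_card_Union:
  assumes "graph G" "is_matching G M"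
  shows "card (\<Union>M) = 2 * card M"
proof -
  interpret graph G by fact
  have two: "card e = 2" if e: "e \<in> M" for e
  proof -
    obtain u v where "e = {u, v}" "u \<rightarrow>\<^bsub>G\<^esub> v"
      using assms(2) e unfolding is_matching_def edge_set_def by blast
    then show ?thesis
      using adj_not_same by (cases "u = v") auto
  qed
  then have "finite e" if "e \<in> M" for e
    using that by (simp add: card_ge_0_finite)
  then have "card (\<Union>M) = (\<Sum>e\<in>M. card e)"
    using assms(2) by (intro card_Union_disjoint) (auto simp: is_matching_def)
  then show ?thesis
    using two by simp
qed

lemma (in alternating_form) independent_iff_independent_cols:
  assumes A: "A \<in> carrier_mat n n" and h: "h ` V = {..<n}"
    and a: "\<And>u v. u \<in> V \<Longrightarrow> v \<in> V \<Longrightarrow> a u v = A $$ (h u, h v)"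
    and S: "S \<subseteq> V"
  shows "independent S \<longleftrightarrow> independent_cols A h S"
proof -
  have rows: "(\<forall>i<dim_row A. P i) \<longleftrightarrow> (\<forall>u\<in>V. P (h u))" for P
    using A h by (metis carrier_matD(1) image_iff lessThan_iff)
  have app: "app x u = (\<Sum>v\<in>S. A $$ (h u, h v) * x v)" if "u \<in> V" "supported S x" for x u
  proof -
    have "app x u = (\<Sum>v\<in>S. a u v * x v)"
      unfolding app_def using S that finite_V
      by (intro sum.mono_neutral_right) (auto simp: supported_def)
    also have "\<dots> = (\<Sum>v\<in>S. A $$ (h u, h v) * x v)"
      using S that a by (intro sum.cong) auto
    finally show ?thesis .
  qed
  show ?thesis
  proof
    assume ind: "independent S"
    show "independent_cols A h S"
      unfolding independent_cols_def rows
    proof (intro allI impI ballI)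
      fix x v assume x: "\<forall>u\<in>V. (\<Sum>v\<in>S. A $$ (h u, h v) * x v) = 0" and v: "v \<in> S"
      \<comment> \<open>The values of \<open>x\<close> off \<open>S\<close> are arbitrary, so they
        are cut to 0 to make the vector supported.\<close>
      define y where "y w = (if w \<in> S then x w else 0)" for w
      have y: "supported S y"
        by (simp add: supported_def y_def)
      have "app y u = 0" if "u \<in> V" for u
        using x that by (simp add: app[OF that y] y_def)
      with ind y have "y v = 0"
        by (simp add: independent_def)
      with v show "x v = 0"
        by (simp add: y_def)
    qed
  next
    assume ind: "independent_cols A h S"
    show "independent S"
      unfolding independent_def
    proof (intro allI impI)
      fix x j assume x: "supported S x" "\<forall>u\<in>V. app x u = 0"
      then have "\<forall>v\<in>S. x v = 0"
        using ind app unfolding independent_cols_def rows by simp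
      with x(1) show "x j = 0"
        by (auto simp: supported_def)
    qed
  qed
qed

text \<open>\<open>A\<close> is arbitrary in its class, so all ranks coincide. An independent column
  set attaining the rank is nonsingular, hence perfectly matched; conversely the vertices covered by
  a maximum matching form a nonsingular set.\<close>

lemma rank_skew_matrix:
  fixes A :: "'f::field mat"
  assumes char: "CHAR('f) \<noteq> 2" and "graph G"
    and acyclic: "\<nexists>p. undirected_cycle G p \<and> even (length p)"
    and vs: "distinct vs" "set vs = verts G"
    and A: "A \<in> skew_matrices vs G"
  shows "vec_space.rank (length vs) A = 2 * matching_number G"
proof -
  interpret graph G by fact
  let ?n = "length vs"
  define h where "h = the_inv_into {..<?n} ((!) vs)"
  have bij: "bij_betw ((!) vs) {..<?n} (verts G)"
    using vs by (simp add: bij_betw_nth)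
  then have h: "h ` verts G = {..<?n}"
    unfolding h_def by (metis bij_betw_imp_surj_on bij_betw_the_inv_into)
  have h_less: "h u < ?n" if "u \<in> verts G" for u
    using h that by blast
  have nth_h: "vs ! h u = u" if "u \<in> verts G" for u
    using bij that unfolding h_def by (metis bij_betw_def f_the_inv_into_f)
  have carrier: "A \<in> carrier_mat ?n ?n"
    using A by (simp add: skew_matrices_def)
  have A_skew: "A $$ (i, j) = - A $$ (j, i)" if "i < ?n" "j < ?n" for i j
  proof -
    have "transpose_mat A $$ (j, i) = (- A) $$ (j, i)"
      using A by (simp add: skew_matrices_def)
    then show ?thesis
      using that carrier by simp
  qed
  have two: "(2 :: 'f) \<noteq> 0"
  proof
    assume "(2 :: 'f) = 0"
    then have "of_nat 2 = (0 :: 'f)"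
      by simp
    then have "CHAR('f) dvd 2"
      by (simp only: of_nat_eq_0_iff_char_dvd)
    then have "CHAR('f) = 1 \<or> CHAR('f) = 2"
      by (metis dvd_imp_le dvd_0_left_iff le_Suc_eq le_zero_eq numeral_2_eq_2 One_nat_def zero_less_numeral zero_neq_numeral)
    then show False
      using char CHAR_not_1 by auto
  qed
  \<comment> \<open>Skew-symmetry gives only that twice the diagonal entry is 0; the characteristic
    assumption does the rest.\<close>
  have A_diag: "A $$ (i, i) = 0" if "i < ?n" for i
  proof -
    have "A $$ (i, i) + A $$ (i, i) = 0"
      using A_skew[OF that that] by (rule eq_neg_iff_add_eq_0[THEN iffD1])
    then have "2 * A $$ (i, i) = 0"
      by (simp only: mult_2)
    then show ?thesis
      using two by simp
  qed
  define a where "a u v = A $$ (h u, h v)" for u v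
  interpret alternating_form "verts G" a
  proof
    show "a u v = - a v u" if "u \<in> verts G" "v \<in> verts G" for u v
      unfolding a_def using that by (intro A_skew h_less)
    show "a u u = 0" if "u \<in> verts G" for u
      unfolding a_def using that by (intro A_diag h_less)
  qed (rule finite_verts)
  have entry: "a u v \<noteq> 0 \<longleftrightarrow> u \<rightarrow>\<^bsub>G\<^esub> v" if "u \<in> verts G" "v \<in> verts G" for u v
  proof (cases "u = v")
    case True
    then show ?thesis
      using diag[OF that(1)] adj_not_same[of u] by auto
  next
    case False
    then have "h u \<noteq> h v"
      using nth_h that by metis
    then show ?thesis
      using A h_less nth_h that by (simp add: skew_matrices_def a_def)
  qed
  have "edges = edge_set G"
    using entry adj_in_verts unfolding edges_def edge_set_def by blast
  then have pm: "perfect_matching M S \<longleftrightarrow> is_matching G M \<and> \<Union>M = S" for M S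
    by (simp add: perfect_matching_def is_matching_def)
  have cols: "independent S \<longleftrightarrow> independent_cols A h S" if "S \<subseteq> verts G" for S
    using independent_iff_independent_cols[OF carrier h _ that] by (simp add: a_def)
  have card_le: "card S \<le> vec_space.rank ?n A" if "independent S" "S \<subseteq> verts G" for S
  proof (rule card_independent_cols_le_rank[of A h S ?n ?n])
    show "finite S"
      using that finite_subset finite_verts by blast
  qed (use that cols carrier h in auto)
  note cards = matching_cards_finite_nonempty[OF \<open>graph G\<close>]
  show ?thesis
  proof (rule antisym)
    obtain S where S: "S \<subseteq> verts G" "card S = vec_space.rank ?n A" "independent_cols A h S"
      using rank_attained_by_independent_cols[OF carrier h finite_verts] .
    \<comment> \<open>\<open>S\<close> already has as many elements as the rank, so no larger set of
      columns is independent.\<close>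
    have "nonsingular S"
    proof (rule maximal_independent_imp_nonsingular)
      fix T assume T: "S \<subset> T" "T \<subseteq> verts G"
      then have "card S < card T"
        using psubset_card_mono finite_subset finite_verts by metis
      then show "\<not> independent T"
        using card_le[of T] T S(2) by auto
    qed (use S cols in auto)
    then have "\<exists>M. perfect_matching M S"
      using S(1) by (rule nonsingular_imp_perfect_matching)
    then obtain M where M: "is_matching G M" "\<Union>M = S"
      unfolding pm by (elim exE conjE)
    then have "card M \<le> matching_number G"
      unfolding matching_number_def using cards(1) by (intro Max_ge) auto
    then show "vec_space.rank ?n A \<le> 2 * matching_number G"
      using matching_card_Union[OF \<open>graph G\<close> M(1)] M(2) S(2) by simp
  next
    obtain M where M: "is_matching G M" "card M = matching_number G"
      using Max_in[OF cards] unfolding matching_number_def by auto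
    have perfect: "perfect_matching M (\<Union>M)"
      using M(1) by (simp add: pm)
    have "nonsingular (\<Union>M)"
    proof (rule unique_perfect_matching_imp_nonsingular)
      show "N = N'" if "perfect_matching N S" "perfect_matching N' S" for S N N'
        using that acyclic matchings_differ_imp_even_cycle[OF \<open>graph G\<close>, of N N'] pm by metis
    qed (rule perfect)
    moreover have "\<Union>M \<subseteq> verts G"
      using M(1) by (auto simp: is_matching_def edge_set_def dest: adj_in_verts)
    ultimately have "card (\<Union>M) \<le> vec_space.rank ?n A"
      using nonsingular_imp_independent card_le by blast
    then show "2 * matching_number G \<le> vec_space.rank ?n A"
      using matching_card_Union[OF \<open>graph G\<close> M(1)] M(2) by simp
  qed
qed

theorem theorem3p3:
  fixes G :: "('v, 'e) pre_digraph" and vs :: "'v list"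
  assumes "CHAR('f::field) \<noteq> 2"
    and "graph G"
    and "Digraph_Component.connected G"
    and "\<nexists>p. undirected_cycle G p \<and> even (length p)"
    and "distinct vs" and "set vs = verts G"
  shows "min_skew_rank TYPE('f) vs G = 2 * matching_number G \<and>
    2 * matching_number G = max_skew_rank TYPE('f) vs G"
proof -
  have "skew_ranks TYPE('f) vs G \<subseteq> {2 * matching_number G}"
    using rank_skew_matrix[OF assms(1,2,4-6)] by (auto simp: skew_ranks_def)
  then have "skew_ranks TYPE('f) vs G = {2 * matching_number G}"
    using skew_ranks_nonempty[OF assms(2), of "TYPE('f)" vs] by (simp add: subset_singleton_iff)
  then show ?thesis
    by (simp add: min_skew_rank_def max_skew_rank_def)
qed

end
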